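(* Consider the ad-auction algorithm described in the context, run with parameter $\eta\in(0,1]$. It is $(1-\eta)$-consistent and $\frac{1-1/C}{1+R_{\max}}$-robust, i.e., for every instance $I$ (with predictions), $$\mathcal{A}(I)\ge(1-\eta)\,\mathcal{P}(I)\quad\text{and}\quad \mathcal{A}(I)\ge\frac{1-1/C}{1+R_{\max}}\,\mathcal{O}(I).$$ Moreover, the robustness $\frac{1-1/C}{1+R_{\max}}$ tends to $1-e^{-\eta}$ as $R_{\max}\to0$.
   Context: Ad-auctions: $m$ buyers with budgets $B_i>0$; items $e$ arrive online; on arrival of $e$ each buyer $i$ reveals a bid $b_{i,e}\ge0$. The fractional offline problem: maximize $\sum_{e}\sum_i b_{i,e}x_{i,e}$ subject to $\sum_i x_{i,e}\le1$ for all $e$, $\sum_e b_{i,e}x_{i,e}\le B_i$ for all $i$, $x\ge0$; $\mathcal{O}(I)$ is its optimal value. Let $R_{\max}=\max_{i,e} b_{i,e}/B_i$, assume $0<R_{\max}\le 1$, and let $C=(1+R_{\max})^{\eta/R_{\max}}$. Each item $e$ comes with a prediction: at most one buyer $i$ with $x^{\mathrm{pred}}_{i,e}=1$, all others $0$; $\mathcal{P}(I)=\sum_{i,e}b_{i,e}x^{\mathrm{pred}}_{i,e}$ if the predicted allocation respects all budgets and $\mathcal{P}(I)=0$ otherwise. $\mathcal{A}(I)=\sum_{i,e}b_{i,e}x_{i,e}$ is the revenue of the algorithm's output. A fictitious buyer $0$ with $b_{0,e}=0$ for all $e$ is used. Algorithm: initially all $\alpha_i=0$. On arrival of item $e$: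 (1) let $i^*$ be the buyer with $x^{\mathrm{pred}}_{i^*,e}=1$; if there is no such buyer, or the predicted allocation of the items arrived so far violates some budget, set $i^*=0$. (2) Let $i$ be a buyer maximizing $b_{i',e}(1-\alpha_{i'})$; if this maximum is $\le0$ set $i=0$. (3) If $b_{i,e}<b_{i^*,e}$: set $x_{i,e}=\eta$ and $x_{i^*,e}=1-\eta$; otherwise set $x_{i,e}=1$. (4) Update $\alpha_i\leftarrow\alpha_i\bigl(1+\frac{b_{i,e}}{B_i}\bigr)+\frac{b_{i,e}}{B_i}\cdot\frac{1}{C-1}$. All other $x_{i',e}$ are $0$; assignment to buyer $0$ means the fraction is unallocated. *)

theory Defs
  imports Complex_Main
begin

text \<open>
  The real buyers are \<open>1, \<dots>, num_buyers\<close>; index 0 is the fictitious buyer.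
  The items \<open>0, \<dots>, num_items - 1\<close> are numbered in their order of arrival.
  Bids, predictions and allocations take the buyer first and the item second.
\<close>

record ad_auction =
  num_buyers :: nat
  num_items :: nat
  budget :: "nat \<Rightarrow> real"
  bid :: "nat \<Rightarrow> nat \<Rightarrow> real"
  xpred :: "nat \<Rightarrow> nat \<Rightarrow> real"

definition buyers :: "ad_auction \<Rightarrow> nat set" where
  "buyers I = {1..num_buyers I}"

definition items :: "ad_auction \<Rightarrow> nat set" where
  "items I = {..<num_items I}"

definition valid_auction :: "ad_auction \<Rightarrow> bool" where
  "valid_auction I \<longleftrightarrow>
     num_buyers I \<ge> 1 \<and> num_items I \<ge> 1 \<and>
     (\<forall>i\<in>buyers I. budget I i > 0) \<and>
     (\<forall>i\<in>buyers I. \<forall>e\<in>items I. bid I i e \<ge> 0) \<and>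
     (\<forall>e. bid I 0 e = 0) \<and>
     (\<forall>e\<in>items I. (\<forall>i\<in>buyers I. xpred I i e \<in> {0, 1}) \<and>
        card {i \<in> buyers I. xpred I i e = 1} \<le> 1)"

definition R_max :: "ad_auction \<Rightarrow> real" where
  "R_max I = Max {bid I i e / budget I i | i e. i \<in> buyers I \<and> e \<in> items I}"

definition C_const :: "real \<Rightarrow> real \<Rightarrow> real" where
  "C_const \<eta> R = (1 + R) powr (\<eta> / R)"

text \<open>
  Bids are counted in full: the revenue is not truncated at the budgets. The sum ranges over
  real buyers only, so fractions given to buyer 0 are unallocated.
\<close>

definition revenue :: "ad_auction \<Rightarrow> (nat \<Rightarrow> nat \<Rightarrow> real) \<Rightarrow> real" where
  "revenue I x = (\<Sum>e\<in>items I. \<Sum>i\<in>buyers I. bid I i e * x i e)"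

definition feasible :: "ad_auction \<Rightarrow> (nat \<Rightarrow> nat \<Rightarrow> real) \<Rightarrow> bool" where
  "feasible I x \<longleftrightarrow>
     (\<forall>e\<in>items I. (\<Sum>i\<in>buyers I. x i e) \<le> 1) \<and>
     (\<forall>i\<in>buyers I. (\<Sum>e\<in>items I. bid I i e * x i e) \<le> budget I i) \<and>
     (\<forall>i\<in>buyers I. \<forall>e\<in>items I. x i e \<ge> 0)"

text \<open>
  The set below contains 0 and is bounded above by the sum of the budgets, so on valid
  instances the supremum is a genuine one.
\<close>

definition opt_value :: "ad_auction \<Rightarrow> real" where
  "opt_value I = Sup {revenue I x | x. feasible I x}"

definition pred_value :: "ad_auction \<Rightarrow> real" where
  "pred_value I =
     (if \<forall>i\<in>buyers I. (\<Sum>e\<in>items I. bid I i e * xpred I i e) \<le> budget I i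
      then revenue I (xpred I) else 0)"

text \<open>The buyer \<open>i\<^sup>*\<close> trusted from the prediction; the items that have arrived so far are \<open>0, \<dots>, e\<close>.\<close>

definition pred_buyer :: "ad_auction \<Rightarrow> nat \<Rightarrow> nat" where
  "pred_buyer I e =
     (if (\<exists>i\<in>buyers I. xpred I i e = 1) \<and>
         (\<forall>i\<in>buyers I. (\<Sum>e'\<le>e. bid I i e' * xpred I i e') \<le> budget I i)
      then (THE i. i \<in> buyers I \<and> xpred I i e = 1) else 0)"

text \<open>
  A relation, since ties between maximizing buyers may be broken arbitrarily.
\<close>

definition greedy_buyer :: "ad_auction \<Rightarrow> (nat \<Rightarrow> real) \<Rightarrow> nat \<Rightarrow> nat \<Rightarrow> bool" where
  "greedy_buyer I \<alpha> e i \<longleftrightarrow>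
     (\<exists>k\<in>buyers I.
        (\<forall>i'\<in>buyers I. bid I i' e * (1 - \<alpha> i') \<le> bid I k e * (1 - \<alpha> k)) \<and>
        i = (if bid I k e * (1 - \<alpha> k) \<le> 0 then 0 else k))"

text \<open>
  The fractions of item \<open>e\<close> given to each buyer when \<open>i\<close> is the greedy choice.
  In the first case \<open>i\<close> and \<open>i\<^sup>*\<close> differ, so the two updates do not collide.
\<close>

definition item_allocation :: "real \<Rightarrow> ad_auction \<Rightarrow> nat \<Rightarrow> nat \<Rightarrow> nat \<Rightarrow> real" where
  "item_allocation \<eta> I e i =
     (let istar = pred_buyer I e in
      if bid I i e < bid I istar e
      then (\<lambda>_. 0)(i := \<eta>, istar := 1 - \<eta>)
      else (\<lambda>_. 0)(i := 1))"

text \<open>For the fictitious buyer both bid terms vanish, so its budget is irrelevant.\<close>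

definition update_dual ::
    "real \<Rightarrow> ad_auction \<Rightarrow> nat \<Rightarrow> nat \<Rightarrow> (nat \<Rightarrow> real) \<Rightarrow> nat \<Rightarrow> real" where
  "update_dual \<eta> I e i \<alpha> =
     \<alpha>(i := \<alpha> i * (1 + bid I i e / budget I i)
            + bid I i e / budget I i * (1 / (C_const \<eta> (R_max I) - 1)))"

text \<open>
  \<open>reaches \<eta> I t \<alpha> x\<close>: after the first \<open>t\<close> arrivals the algorithm can be in a state with
  dual values \<open>\<alpha>\<close> and (partial) allocation \<open>x\<close>.
\<close>

inductive reaches ::
    "real \<Rightarrow> ad_auction \<Rightarrow> nat \<Rightarrow> (nat \<Rightarrow> real) \<Rightarrow> (nat \<Rightarrow> nat \<Rightarrow> real) \<Rightarrow> bool"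
  for \<eta> :: real and I :: ad_auction where
  start: "reaches \<eta> I 0 (\<lambda>_. 0) (\<lambda>_ _. 0)"
| arrival: "reaches \<eta> I e \<alpha> x \<Longrightarrow> e < num_items I \<Longrightarrow> greedy_buyer I \<alpha> e i \<Longrightarrow>
    reaches \<eta> I (Suc e) (update_dual \<eta> I e i \<alpha>)
      (\<lambda>j. (x j)(e := item_allocation \<eta> I e i j))"

definition alg_output :: "real \<Rightarrow> ad_auction \<Rightarrow> (nat \<Rightarrow> nat \<Rightarrow> real) \<Rightarrow> bool" where
  "alg_output \<eta> I x \<longleftrightarrow> (\<exists>\<alpha>. reaches \<eta> I (num_items I) \<alpha> x)"

definition robustness :: "real \<Rightarrow> real \<Rightarrow> real" where
  "robustness \<eta> R = (1 - 1 / C_const \<eta> R) / (1 + R)"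

lemma greedy_buyer_exists:
  assumes "valid_auction I"
  shows "\<exists>i. greedy_buyer I \<alpha> e i"
proof -
  let ?v = "\<lambda>i. bid I i e * (1 - \<alpha> i)"
  have fin: "finite (?v ` buyers I)" and ne: "?v ` buyers I \<noteq> {}"
    using assms by (auto simp: buyers_def valid_auction_def)
  from Max_in[OF fin ne] obtain k where k: "k \<in> buyers I" "Max (?v ` buyers I) = ?v k"
    by auto
  have "\<forall>i'\<in>buyers I. ?v i' \<le> ?v k"
    using Max_ge[OF fin] k(2) by (metis imageI)
  with k(1) show ?thesis
    unfolding greedy_buyer_def by blast
qed

text \<open>Every valid instance admits a complete run of the algorithm.\<close>

lemma alg_output_exists:
  assumes "valid_auction I"
  shows "\<exists>x. alg_output \<eta> I x"
proof -
  have "t \<le> num_items I \<Longrightarrow> \<exists>\<alpha> x. reaches \<eta> I t \<alpha> x" for t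
  proof (induction t)
    case 0
    show ?case using reaches.start by blast
  next
    case (Suc t)
    then obtain \<alpha> x where "reaches \<eta> I t \<alpha> x" by auto
    moreover obtain i where "greedy_buyer I \<alpha> t i"
      using greedy_buyer_exists[OF assms] by blast
    ultimately show ?case using Suc.prems reaches.arrival by (metis Suc_le_eq)
  qed
  from this[of "num_items I"] show ?thesis by (auto simp: alg_output_def)
qed

end

theory Submission
  imports Defs "HOL-Real_Asymp.Real_Asymp"
begin

text \<open>
  On each arrival the revenue is a convex combination of the bids of the greedy and the trusted
  buyer with all weight on the greedy bid unless the trusted one is larger. Hence it dominates
  both the greedy bid and \<open>1 - \<eta>\<close> times the trusted bid. The latter gives consistency. For
  robustness, the offline problem has the dual
  \<open>minimize \<Sum>i. B\<^sub>i * \<alpha>\<^sub>i + \<Sum>e. z\<^sub>e\<close> subject to \<open>b\<^sub>i\<^sub>e * \<alpha>\<^sub>i + z\<^sub>e \<ge> b\<^sub>i\<^sub>e\<close>, and with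
  \<open>z\<^sub>e = b\<^sub>i\<^sub>e * (1 - \<alpha>\<^sub>i)\<close> for the greedy buyer \<open>i\<close> the dual objective grows by exactly
  \<open>C / (C - 1)\<close> times the greedy bid. Weak duality then bounds the optimum. Since the revenue is
  not truncated at the budgets, this even gives the factor \<open>1 - 1 / C\<close>.
\<close>

lemma finite_buyers [simp]: "finite (buyers I)"
  by (simp add: buyers_def)

lemma zero_notin_buyers [simp]: "0 \<notin> buyers I"
  by (simp add: buyers_def)

lemma mem_items [simp]: "e \<in> items I \<longleftrightarrow> e < num_items I"
  by (simp add: items_def)

section \<open>Valid instances, predictions and the revenue of a single item\<close>

context
  fixes I :: ad_auction
  assumes valid: "valid_auction I"
begin

lemma budget_pos: "i \<in> buyers I \<Longrightarrow> 0 < budget I i"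
  and bid_nonneg: "i \<in> buyers I \<Longrightarrow> e < num_items I \<Longrightarrow> 0 \<le> bid I i e"
  and bid_zero [simp]: "bid I 0 e = 0"
  using valid by (auto simp: valid_auction_def)

lemma bid_nonneg':
  "i \<in> insert 0 (buyers I) \<Longrightarrow> e < num_items I \<Longrightarrow> 0 \<le> bid I i e"
  using bid_nonneg by auto

lemma pred_unique:
  assumes "e < num_items I" "i \<in> buyers I" "j \<in> buyers I" "xpred I i e = 1" "xpred I j e = 1"
  shows "i = j"
proof -
  have "card {i \<in> buyers I. xpred I i e = 1} \<le> Suc 0"
    using valid assms(1) by (auto simp: valid_auction_def)
  then show ?thesis
    using assms by (subst (asm) card_le_Suc0_iff_eq) auto
qed

lemma xpred_cases:
  "i \<in> buyers I \<Longrightarrow> e < num_items I \<Longrightarrow> xpred I i e = 0 \<or> xpred I i e = 1"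
  using valid by (auto simp: valid_auction_def)

lemma the_pred_buyer:
  assumes "e < num_items I" "i \<in> buyers I" "xpred I i e = 1"
  shows "(THE i. i \<in> buyers I \<and> xpred I i e = 1) = i"
  using assms pred_unique by blast

lemma pred_buyer_mem: "e < num_items I \<Longrightarrow> pred_buyer I e \<in> insert 0 (buyers I)"
  using the_pred_buyer by (auto simp: pred_buyer_def)

lemma greedy_buyer_mem: "greedy_buyer I \<alpha> e i \<Longrightarrow> i \<in> insert 0 (buyers I)"
  by (auto simp: greedy_buyer_def)

text \<open>Covers buyer 0 uniformly: it is absent from the sum, and its bid on the right is
  0.\<close>

lemma sum_bid_single:
  "i \<in> insert 0 (buyers I) \<Longrightarrow> (\<Sum>j\<in>buyers I. bid I j e * (if j = i then c else 0)) = bid I i e * c"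
  by (auto simp: if_distrib[of "(*) _"] sum.delta cong: if_cong)

lemma item_revenue:
  assumes "e < num_items I" "i \<in> insert 0 (buyers I)"
  shows "(\<Sum>j\<in>buyers I. bid I j e * item_allocation \<eta> I e i j) =
    (if bid I i e < bid I (pred_buyer I e) e
     then \<eta> * bid I i e + (1 - \<eta>) * bid I (pred_buyer I e) e else bid I i e)"
proof (cases "bid I i e < bid I (pred_buyer I e) e")
  case True
  then have alloc: "item_allocation \<eta> I e i j =
      (if j = i then \<eta> else 0) + (if j = pred_buyer I e then 1 - \<eta> else 0)" for j
    by (auto simp: item_allocation_def)
  show ?thesis
    using True assms(2) pred_buyer_mem[OF assms(1)]
    by (simp only: alloc distrib_left sum.distrib sum_bid_single) simp
next
  case False
  then have "item_allocation \<eta> I e i j = (if j = i then 1 else 0)" for j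
    by (simp add: item_allocation_def Let_def)
  then show ?thesis
    using False sum_bid_single[OF assms(2), of e 1] by simp
qed

text \<open>Arrival \<open>d\<close> writes column \<open>d\<close> only, so column \<open>e\<close>
  survives later arrivals. This reduces revenue claims to a single item, whatever the dual values
  were.\<close>

lemma reaches_allocation:
  assumes "reaches \<eta> I t \<alpha> x" "e < t"
  shows "\<exists>i\<in>insert 0 (buyers I). \<forall>j. x j e = item_allocation \<eta> I e i j"
  using assms
proof induction
  case (arrival d \<alpha> x i)
  then show ?case
    using greedy_buyer_mem[OF arrival(3)] by (cases "e = d") auto
qed simp

text \<open>Bids and predictions are nonnegative, so respecting the budgets in total implies
  respecting them on every prefix. Hence the trusted buyer is never reset to 0 by a budget
  violation.\<close>

lemma pred_value_summand:
  assumes "e < num_items I"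
    and budgets: "\<And>i. i \<in> buyers I \<Longrightarrow> (\<Sum>e\<in>items I. bid I i e * xpred I i e) \<le> budget I i"
  shows "(\<Sum>i\<in>buyers I. bid I i e * xpred I i e) = bid I (pred_buyer I e) e"
proof (cases "\<exists>i\<in>buyers I. xpred I i e = 1")
  case True
  then obtain i where i: "i \<in> buyers I" "xpred I i e = 1"
    by blast
  have "(\<Sum>e'\<le>e. bid I k e' * xpred I k e') \<le> budget I k" if "k \<in> buyers I" for k
  proof -
    have "(\<Sum>e'\<le>e. bid I k e' * xpred I k e') \<le> (\<Sum>e'\<in>items I. bid I k e' * xpred I k e')"
      using assms(1) that bid_nonneg xpred_cases
      by (intro sum_mono2) (auto simp: items_def, fastforce)
    with budgets[OF that] show ?thesis
      by linarith
  qed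
  then have "pred_buyer I e = i"
    using i the_pred_buyer[OF assms(1)] by (auto simp: pred_buyer_def)
  moreover have "xpred I j e = (if j = i then 1 else 0)" if "j \<in> buyers I" for j
    using that i xpred_cases[OF that assms(1)] pred_unique[OF assms(1)] by auto
  ultimately show ?thesis
    using i sum_bid_single[of i e 1] by simp
next
  case False
  then have "(\<Sum>i\<in>buyers I. bid I i e * xpred I i e) = 0"
    using xpred_cases assms(1) by (intro sum.neutral) auto
  with False show ?thesis
    by (simp add: pred_buyer_def)
qed

section \<open>LP duality for the offline problem\<close>

text \<open>Weight each dual constraint by \<open>x i e\<close> and sum; the budget constraints then
  bound the \<alpha> part, and the constraint of one unit per item bounds the \<open>z\<close>
  part.\<close>

lemma weak_duality:
  assumes dual: "\<And>i e. i \<in> buyers I \<Longrightarrow> e < num_items I \<Longrightarrow> bid I i e * (1 - \<alpha> i) \<le> z e"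
    and \<alpha>: "\<And>i. i \<in> buyers I \<Longrightarrow> 0 \<le> \<alpha> i"
    and z: "\<And>e. e < num_items I \<Longrightarrow> 0 \<le> z e"
  shows "opt_value I \<le> (\<Sum>i\<in>buyers I. budget I i * \<alpha> i) + (\<Sum>e\<in>items I. z e)"
  unfolding opt_value_def
proof (rule cSup_least)
  have "feasible I (\<lambda>_ _. 0)"
    using budget_pos by (auto simp: feasible_def less_imp_le)
  then show "{revenue I x |x. feasible I x} \<noteq> {}"
    by blast
next
  fix r assume "r \<in> {revenue I x |x. feasible I x}"
  then obtain x where r: "r = revenue I x" and x: "feasible I x"
    by blast
  have "r \<le> (\<Sum>e\<in>items I. \<Sum>i\<in>buyers I. bid I i e * x i e * \<alpha> i + z e * x i e)"
    unfolding r revenue_def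
  proof (intro sum_mono)
    fix e i assume *: "e \<in> items I" "i \<in> buyers I"
    then have "bid I i e * (1 - \<alpha> i) * x i e \<le> z e * x i e"
      using x dual by (intro mult_right_mono) (auto simp: feasible_def)
    then show "bid I i e * x i e \<le> bid I i e * x i e * \<alpha> i + z e * x i e"
      by (simp add: algebra_simps)
  qed
  also have "\<dots> = (\<Sum>i\<in>buyers I. (\<Sum>e\<in>items I. bid I i e * x i e) * \<alpha> i)
      + (\<Sum>e\<in>items I. z e * (\<Sum>i\<in>buyers I. x i e))"
    by (simp add: sum.distrib sum_distrib_left sum_distrib_right
        sum.swap[of _ "items I" "buyers I"])
  also have "\<dots> \<le> (\<Sum>i\<in>buyers I. budget I i * \<alpha> i) + (\<Sum>e\<in>items I. z e)"
    using x \<alpha> z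
    by (intro add_mono sum_mono mult_right_mono mult_left_le) (auto simp: feasible_def)
  finally show "r \<le> (\<Sum>i\<in>buyers I. budget I i * \<alpha> i) + (\<Sum>e\<in>items I. z e)" .
qed

text \<open>The zero allocation has revenue 0, and the sum of the budgets bounds the set, so its
  supremum lies above 0.\<close>

lemma opt_value_nonneg: "0 \<le> opt_value I"
  unfolding opt_value_def
proof (rule cSup_upper)
  have "feasible I (\<lambda>_ _. 0)"
    using budget_pos by (auto simp: feasible_def less_imp_le)
  then show "0 \<in> {revenue I x |x. feasible I x}"
    by (force simp: revenue_def)
next
  have "revenue I x \<le> (\<Sum>i\<in>buyers I. budget I i)" if "feasible I x" for x
    using that unfolding revenue_def
    by (subst sum.swap) (auto simp: feasible_def intro!: sum_mono)
  then show "bdd_above {revenue I x |x. feasible I x}"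
    by (auto intro!: bdd_aboveI)
qed

text \<open>The weight \<open>budget I i\<close> cancels the denominators of the update.\<close>

lemma dual_update_cost:
  assumes "i \<in> buyers I"
  shows "(\<Sum>j\<in>buyers I. budget I j * update_dual \<eta> I e i \<alpha> j) =
    (\<Sum>j\<in>buyers I. budget I j * \<alpha> j) + bid I i e * \<alpha> i + bid I i e / (C_const \<eta> (R_max I) - 1)"
proof -
  have "budget I j * update_dual \<eta> I e i \<alpha> j = budget I j * \<alpha> j +
      (if j = i then bid I i e * \<alpha> i + bid I i e / (C_const \<eta> (R_max I) - 1) else 0)" if "j \<in> buyers I" for j
    using budget_pos[OF that] by (auto simp: update_dual_def distrib_left)
  then show ?thesis
    using assms by (simp add: sum.distrib)
qed

section \<open>Revenue bounds per item and consistency\<close>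

context
  fixes \<eta> :: real
  assumes eta: "0 < \<eta>" "\<eta> \<le> 1"
begin

lemma greedy_bid_le_item_revenue:
  assumes "e < num_items I" "i \<in> insert 0 (buyers I)"
  shows "bid I i e \<le> (\<Sum>j\<in>buyers I. bid I j e * item_allocation \<eta> I e i j)"
proof -
  have "0 \<le> (1 - \<eta>) * (bid I (pred_buyer I e) e - bid I i e)"
    if "bid I i e < bid I (pred_buyer I e) e"
    using that eta by simp
  then show ?thesis
    unfolding item_revenue[OF assms] by (auto simp: algebra_simps)
qed

text \<open>If the item is split, the surplus is \<open>\<eta> * bid I i e\<close>; otherwise the
  greedy bid is at least the trusted bid, hence at least its (1 - \<eta>) multiple.\<close>

lemma pred_bid_le_item_revenue:
  assumes "e < num_items I" "i \<in> insert 0 (buyers I)"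
  shows "(1 - \<eta>) * bid I (pred_buyer I e) e \<le>
    (\<Sum>j\<in>buyers I. bid I j e * item_allocation \<eta> I e i j)"
proof -
  have "0 \<le> \<eta> * bid I i e" "0 \<le> \<eta> * bid I (pred_buyer I e) e"
    using eta bid_nonneg' assms pred_buyer_mem by auto
  then show ?thesis
    unfolding item_revenue[OF assms] by (auto simp: algebra_simps)
qed

theorem consistency:
  assumes "alg_output \<eta> I x"
  shows "(1 - \<eta>) * pred_value I \<le> revenue I x"
proof -
  obtain \<alpha> where \<alpha>: "reaches \<eta> I (num_items I) \<alpha> x"
    using assms by (auto simp: alg_output_def)
  have step: "(1 - \<eta>) * bid I (pred_buyer I e) e \<le> (\<Sum>j\<in>buyers I. bid I j e * x j e)"
    if "e \<in> items I" for e
    using that reaches_allocation[OF \<alpha>, of e] pred_bid_le_item_revenue[of e] by auto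
  show ?thesis
  proof (cases "\<forall>i\<in>buyers I. (\<Sum>e\<in>items I. bid I i e * xpred I i e) \<le> budget I i")
    case True
    then have "pred_value I = (\<Sum>e\<in>items I. bid I (pred_buyer I e) e)"
      by (auto simp: pred_value_def revenue_def pred_value_summand intro!: sum.cong)
    then show ?thesis
      using step by (auto simp: revenue_def sum_distrib_left intro!: sum_mono)
  next
    \<comment> \<open>An infeasible prediction has value 0, so only nonnegativity of the revenue is
      at stake.\<close>
    case False
    have "0 \<le> (1 - \<eta>) * bid I (pred_buyer I e) e" if "e \<in> items I" for e
      using that eta bid_nonneg'[OF pred_buyer_mem] by simp
    then have "0 \<le> revenue I x"
      unfolding revenue_def by (rule sum_nonneg[OF order_trans[OF _ step]])
    moreover have "pred_value I = 0"
      unfolding pred_value_def using False by (rule if_not_P)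
    ultimately show ?thesis
      by simp
  qed
qed

section \<open>Robustness by a primal-dual invariant\<close>

context
  assumes R: "0 < R_max I"
begin

abbreviation (input) "C \<equiv> C_const \<eta> (R_max I)"

lemma C_gt_1: "1 < C"
  unfolding C_const_def using eta R by (intro gr_one_powr) auto

text \<open>Dual values only grow, so constraints of earlier items stay satisfied.\<close>

lemma update_dual_le:
  assumes "i \<in> insert 0 (buyers I)" "e < num_items I" "0 \<le> \<alpha> i"
  shows "\<alpha> j \<le> update_dual \<eta> I e i \<alpha> j"
proof (cases "i = 0")
  case False
  then have "0 \<le> bid I i e / budget I i"
    using assms bid_nonneg budget_pos by (auto simp: less_imp_le)
  then have "0 \<le> \<alpha> i * (bid I i e / budget I i)" "0 \<le> bid I i e / budget I i * (1 / (C - 1))"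
    using assms(3) C_gt_1 by (intro mult_nonneg_nonneg; simp)+
  then show ?thesis
    by (simp add: update_dual_def distrib_left)
qed (auto simp: update_dual_def)

text \<open>Invariant of the run: a dual solution for the items so far, paid for by the revenue.
  Nonnegativity includes buyer 0 because the greedy choice may be 0.\<close>

lemma dual_solution:
  assumes "reaches \<eta> I t \<alpha> x"
  shows "\<exists>z. (\<forall>i\<in>insert 0 (buyers I). 0 \<le> \<alpha> i) \<and> (\<forall>e<t. 0 \<le> z e) \<and>
    (\<forall>i\<in>buyers I. \<forall>e<t. bid I i e * (1 - \<alpha> i) \<le> z e) \<and>
    (1 - 1 / C) * ((\<Sum>i\<in>buyers I. budget I i * \<alpha> i) + (\<Sum>e<t. z e))
      \<le> (\<Sum>e<t. \<Sum>i\<in>buyers I. bid I i e * x i e)"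
  using assms
proof induction
  case start
  show ?case by simp
next
  case (arrival e \<alpha> x i)
  then obtain z where \<alpha>: "\<And>i. i \<in> insert 0 (buyers I) \<Longrightarrow> 0 \<le> \<alpha> i"
    and z: "\<And>e'. e' < e \<Longrightarrow> 0 \<le> z e'"
    and dual: "\<And>i e'. i \<in> buyers I \<Longrightarrow> e' < e \<Longrightarrow> bid I i e' * (1 - \<alpha> i) \<le> z e'"
    and cost: "(1 - 1 / C) * ((\<Sum>i\<in>buyers I. budget I i * \<alpha> i) + (\<Sum>e<e. z e))
      \<le> (\<Sum>e<e. \<Sum>i\<in>buyers I. bid I i e * x i e)"
    by blast
  define \<beta> where "\<beta> = update_dual \<eta> I e i \<alpha>"
  have i: "i \<in> insert 0 (buyers I)"
    using arrival greedy_buyer_mem by blast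
  have le: "\<alpha> j \<le> \<beta> j" for j
    unfolding \<beta>_def using i arrival(2) \<alpha>[OF i] by (rule update_dual_le)
  \<comment> \<open>The least nonnegative value meeting the constraints of item \<open>e\<close>
    under the old \<alpha>: the greedy maximum, or 0 if buyer 0 was chosen.\<close>
  define ze where "ze = bid I i e * (1 - \<alpha> i)"
  have ze: "0 \<le> ze" "\<And>j. j \<in> buyers I \<Longrightarrow> bid I j e * (1 - \<alpha> j) \<le> ze"
    using arrival(3) by (force simp: ze_def greedy_buyer_def split: if_splits)+
  have dual': "bid I j e' * (1 - \<beta> j) \<le> (z(e := ze)) e'" if "j \<in> buyers I" "e' < Suc e" for j e'
  proof -
    have "bid I j e' * (1 - \<beta> j) \<le> bid I j e' * (1 - \<alpha> j)"
      using le that arrival(2) bid_nonneg by (intro mult_left_mono) auto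
    also have "\<dots> \<le> (z(e := ze)) e'"
      using that dual ze by (auto simp: less_Suc_eq)
    finally show ?thesis .
  qed
  have "(1 - 1 / C) * ((\<Sum>i\<in>buyers I. budget I i * \<beta> i) + ze) =
      (1 - 1 / C) * (\<Sum>i\<in>buyers I. budget I i * \<alpha> i) + bid I i e"
  proof (cases "i = 0")
    case True
    then show ?thesis by (auto simp: \<beta>_def ze_def update_dual_def intro!: sum.cong)
  next
    case False
    \<comment> \<open>The term \<open>bid I i e * \<alpha> i\<close> gained by the update cancels
      against the one subtracted in \<open>ze\<close>. What remains is the bid times C / (C - 1),
      the inverse of 1 - 1 / C.\<close>
    then have "(\<Sum>j\<in>buyers I. budget I j * \<beta> j) + ze =
        (\<Sum>j\<in>buyers I. budget I j * \<alpha> j) + (bid I i e + bid I i e / (C - 1))"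
      using i dual_update_cost[of i \<eta> e \<alpha>] by (simp add: \<beta>_def ze_def algebra_simps)
    moreover have "(1 - 1 / C) * (bid I i e + bid I i e / (C - 1)) = bid I i e"
      using C_gt_1 by (simp add: field_simps)
    ultimately show ?thesis by (simp add: distrib_left)
  qed
  then have "(1 - 1 / C) * ((\<Sum>i\<in>buyers I. budget I i * \<beta> i) + (\<Sum>e'<Suc e. (z(e := ze)) e'))
      \<le> (\<Sum>e'<Suc e. \<Sum>j\<in>buyers I. bid I j e' * ((x j)(e := item_allocation \<eta> I e i j)) e')"
    using cost greedy_bid_le_item_revenue[OF arrival(2) i] by (simp add: distrib_left)
  moreover have "\<forall>i\<in>insert 0 (buyers I). 0 \<le> \<beta> i"
    using \<alpha> le order_trans by blast
  ultimately show ?case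
    using z ze(1) dual' unfolding \<beta>_def
    by (intro exI[of _ "z(e := ze)"]) (auto simp: less_Suc_eq)
qed

theorem revenue_ge_opt:
  assumes "alg_output \<eta> I x"
  shows "(1 - 1 / C) * opt_value I \<le> revenue I x"
proof -
  obtain \<alpha> where "reaches \<eta> I (num_items I) \<alpha> x"
    using assms by (auto simp: alg_output_def)
  from dual_solution[OF this] obtain z where
    dual: "\<And>i. i \<in> buyers I \<Longrightarrow> 0 \<le> \<alpha> i" "\<And>e. e < num_items I \<Longrightarrow> 0 \<le> z e"
      "\<And>i e. i \<in> buyers I \<Longrightarrow> e < num_items I \<Longrightarrow> bid I i e * (1 - \<alpha> i) \<le> z e"
    and cost: "(1 - 1 / C) * ((\<Sum>i\<in>buyers I. budget I i * \<alpha> i) + (\<Sum>e\<in>items I. z e)) \<le> revenue I x"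
    unfolding revenue_def items_def by blast
  have "(1 - 1 / C) * opt_value I \<le>
      (1 - 1 / C) * ((\<Sum>i\<in>buyers I. budget I i * \<alpha> i) + (\<Sum>e\<in>items I. z e))"
    using C_gt_1 dual by (intro mult_left_mono weak_duality) auto
  with cost show ?thesis by linarith
qed

text \<open>Dividing the positive factor 1 - 1 / C by 1 + R only shrinks it, and the optimum is
  nonnegative.\<close>

theorem robustness_bound:
  assumes "alg_output \<eta> I x"
  shows "robustness \<eta> (R_max I) * opt_value I \<le> revenue I x"
proof -
  have "robustness \<eta> (R_max I) \<le> 1 - 1 / C"
    unfolding robustness_def using C_gt_1 R divide_left_mono[of 1 "1 + R_max I" "1 - 1 / C"]
    by simp
  then show ?thesis
    using revenue_ge_opt[OF assms] mult_right_mono[OF _ opt_value_nonneg] by fastforce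
qed

end
end
end

section \<open>The limit of small bids\<close>

text \<open>For R > 0, C equals exp (\<eta> * (ln (1 + R) / R)), and ln (1 + R) / R tends to
  1.\<close>

lemma robustness_limit: "(robustness \<eta> \<longlongrightarrow> 1 - exp (- \<eta>)) (at_right 0)"
proof -
  have "((\<lambda>R::real. ln (1 + R) / R) \<longlongrightarrow> 1) (at_right 0)"
    by real_asymp
  then have "((\<lambda>R. (1 - exp (- (\<eta> * (ln (1 + R) / R)))) / (1 + R))
      \<longlongrightarrow> (1 - exp (- (\<eta> * 1))) / (1 + 0)) (at_right 0)"
    by (intro tendsto_intros) auto
  moreover have "\<forall>\<^sub>F R in at_right 0.
      (1 - exp (- (\<eta> * (ln (1 + R) / R)))) / (1 + R) = robustness \<eta> R"
    using eventually_at_right_less[of "0::real"]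
    by eventually_elim (simp add: robustness_def C_const_def powr_def exp_minus inverse_eq_divide)
  ultimately show ?thesis
    using Lim_transform_eventually by fastforce
qed

theorem theorem2:
  fixes \<eta> :: real
  assumes "0 < \<eta>" and "\<eta> \<le> 1"
  shows "(\<forall>I x. valid_auction I \<and> 0 < R_max I \<and> R_max I \<le> 1 \<and> alg_output \<eta> I x \<longrightarrow>
            revenue I x \<ge> (1 - \<eta>) * pred_value I \<and>
            revenue I x \<ge> robustness \<eta> (R_max I) * opt_value I) \<and>
         (robustness \<eta> \<longlongrightarrow> 1 - exp (- \<eta>)) (at_right 0)"
  using assms consistency robustness_bound robustness_limit by blast

end
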